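(* Let $(\mathfrak g,[\cdot,\cdot],\alpha)$ be a Hom-Lie algebra, let $V$ be a vector space, let $\beta\in GL(V)$, and let $\rho:\mathfrak g\to\mathfrak{gl}(V)$ be a representation of $(\mathfrak g,[\cdot,\cdot],\alpha)$ on $V$ with respect to $\beta$. For every integer $s\ge 0$, the map $d^s$ defined for $k\ge 0$ and $\eta\in C^k(\mathfrak g;V)$ by $$d^s\eta(x_1,\dots,x_{k+1})=\sum_{i=1}^{k+1}(-1)^{i+1}\beta^{k+1+s}\rho(x_i)\beta^{-k-2-s}\,\eta(\alpha(x_1),\dots,\widehat{x_i},\dots,\alpha(x_{k+1}))+\sum_{i<j}(-1)^{i+j}\eta([x_i,x_j],\alpha(x_1),\dots,\widehat{x_{i,j}},\dots,\alpha(x_{k+1}))$$ is a coboundary operator, i.e. $d^s\circ d^s=0$ as a map $C^k(\mathfrak g;V)\to C^{k+2}(\mathfrak g;V)$ for every $k\ge 0$.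
   Context: All vector spaces are over a fixed field. A Hom-Lie algebra is a triple $(\mathfrak g,[\cdot,\cdot],\alpha)$ consisting of a vector space $\mathfrak g$, a skewsymmetric bilinear map $[\cdot,\cdot]:\wedge^2\mathfrak g\to\mathfrak g$ and a linear map $\alpha:\mathfrak g\to\mathfrak g$ such that $\alpha[x,y]=[\alpha(x),\alpha(y)]$ and $[\alpha(x),[y,z]]+[\alpha(y),[z,x]]+[\alpha(z),[x,y]]=0$ for all $x,y,z\in\mathfrak g$. A representation of $(\mathfrak g,[\cdot,\cdot],\alpha)$ on $V$ with respect to $\beta\in\mathfrak{gl}(V)$ is a linear map $\rho:\mathfrak g\to\mathfrak{gl}(V)$ such that for all $x,y\in\mathfrak g$: $\rho(\alpha(x))\circ\beta=\beta\circ\rho(x)$ and $\rho([x,y])\circ\beta=\rho(\alpha(x))\circ\rho(y)-\rho(\alpha(y))\circ\rho(x)$. Here $\beta$ is assumed invertible. $C^k(\mathfrak g;V)$ is the space of linear maps $\wedge^k\mathfrak g\to V$ (skewsymmetric $k$-linear maps from $\mathfrak g^k$ to $V$), with $C^0(\mathfrak g;V)=V$. The notation $\eta(\alpha(x_1),\dots,\widehat{x_i},\dots,\alpha(x_{k+1}))$ means that the entry $\alpha(x_i)$ is omitted, and $\widehat{x_{i,j}}$ means that both entries $\alpha(x_i)$ and $\alpha(x_j)$ are omitted. *)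

theory Defs
  imports Complex_Main "HOL-Library.FuncSet"
begin

text \<open>Vector spaces are types with an explicit scalar multiplication over an arbitrary field, as in
  the theory \<open>HOL.Vector_Spaces\<close>. A linear map out of an exterior power is rendered as a multilinear
  map that vanishes whenever two arguments coincide. In characteristic other than 2 this is the same
  as skewsymmetry; in characteristic 2 it is what a map on the exterior power means.\<close>

locale hom_lie_algebra = vector_space scale
  for scale :: "'f::field \<Rightarrow> 'g::ab_group_add \<Rightarrow> 'g" +
  fixes bracket :: "'g \<Rightarrow> 'g \<Rightarrow> 'g"
    and \<alpha> :: "'g \<Rightarrow> 'g"
  assumes bracket_linear_right: "Vector_Spaces.linear scale scale (\<lambda>y. bracket x y)"
    and bracket_linear_left: "Vector_Spaces.linear scale scale (\<lambda>x. bracket x y)"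
    and bracket_self: "bracket x x = 0"
    and alpha_linear: "Vector_Spaces.linear scale scale \<alpha>"
    and alpha_bracket: "\<alpha> (bracket x y) = bracket (\<alpha> x) (\<alpha> y)"
    and hom_jacobi: "bracket (\<alpha> x) (bracket y z) + bracket (\<alpha> y) (bracket z x)
                       + bracket (\<alpha> z) (bracket x y) = 0"

locale hom_lie_representation =
  hom_lie_algebra scale bracket \<alpha> + V: vector_space scaleV
  for scale :: "'f::field \<Rightarrow> 'g::ab_group_add \<Rightarrow> 'g"
    and bracket :: "'g \<Rightarrow> 'g \<Rightarrow> 'g"
    and \<alpha> :: "'g \<Rightarrow> 'g"
    and scaleV :: "'f \<Rightarrow> 'v::ab_group_add \<Rightarrow> 'v" +
  fixes \<beta> :: "'v \<Rightarrow> 'v"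
    and \<rho> :: "'g \<Rightarrow> 'v \<Rightarrow> 'v"
  assumes beta_linear: "Vector_Spaces.linear scaleV scaleV \<beta>"
    and rho_endo: "Vector_Spaces.linear scaleV scaleV (\<rho> x)"
    and rho_linear: "Vector_Spaces.linear scale scaleV (\<lambda>x. \<rho> x v)"
    and rho_alpha: "\<rho> (\<alpha> x) \<circ> \<beta> = \<beta> \<circ> \<rho> x"
    and rho_bracket: "\<rho> (bracket x y) (\<beta> v) = \<rho> (\<alpha> x) (\<rho> y v) - \<rho> (\<alpha> y) (\<rho> x v)"

text \<open>An element of \<open>C\<^sup>k(g; V)\<close> is a function on lists that vanishes on lists of length other than
  \<open>k\<close>, so that equality of cochains is equality of functions and \<open>C\<^sup>0(g; V)\<close> is identified with
  \<open>V\<close> by evaluation at \<open>[]\<close>.\<close>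

definition cochains ::
  "('f::field \<Rightarrow> 'g::ab_group_add \<Rightarrow> 'g) \<Rightarrow> ('f \<Rightarrow> 'v::ab_group_add \<Rightarrow> 'v) \<Rightarrow> nat \<Rightarrow> ('g list \<Rightarrow> 'v) set"
  where
  "cochains scale scaleV k =
    {\<eta>. (\<forall>xs. length xs \<noteq> k \<longrightarrow> \<eta> xs = 0) \<and>
        (\<forall>xs i. length xs = k \<longrightarrow> i < k \<longrightarrow>
           Vector_Spaces.linear scale scaleV (\<lambda>x. \<eta> (xs[i := x]))) \<and>
        (\<forall>xs i j. length xs = k \<longrightarrow> i < j \<longrightarrow> j < k \<longrightarrow> xs ! i = xs ! j \<longrightarrow> \<eta> xs = 0)}"

text \<open>The operator \<open>d\<^sup>s\<close> on \<open>C\<^sup>k(g; V)\<close>. Indices start at 0 here, so the sign \<open>(-1)\<^sup>i\<^sup>+\<^sup>1\<close> of the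
  usual 1-based formula becomes \<open>(-1)\<^sup>i\<close>, while \<open>(-1)\<^sup>i\<^sup>+\<^sup>j\<close> is unchanged; \<open>nths xs (- A)\<close> omits the
  entries with index in \<open>A\<close>.\<close>

definition hom_lie_coboundary ::
  "('g \<Rightarrow> 'g \<Rightarrow> 'g) \<Rightarrow> ('g \<Rightarrow> 'g) \<Rightarrow> ('f::field \<Rightarrow> 'v::ab_group_add \<Rightarrow> 'v) \<Rightarrow> ('v \<Rightarrow> 'v) \<Rightarrow> ('g \<Rightarrow> 'v \<Rightarrow> 'v)
    \<Rightarrow> nat \<Rightarrow> nat \<Rightarrow> ('g list \<Rightarrow> 'v) \<Rightarrow> 'g list \<Rightarrow> 'v"
  where
  "hom_lie_coboundary bracket \<alpha> scaleV \<beta> \<rho> s k \<eta> xs =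
    (if length xs = k + 1 then
       (\<Sum>i<k+1. scaleV ((- 1) ^ i)
          ((\<beta> ^^ (k + 1 + s)) (\<rho> (xs ! i) ((inv \<beta> ^^ (k + 2 + s))
             (\<eta> (map \<alpha> (nths xs (- {i}))))))))
     + (\<Sum>j<k+1. \<Sum>i<j. scaleV ((- 1) ^ (i + j))
          (\<eta> (bracket (xs ! i) (xs ! j) # map \<alpha> (nths xs (- {i, j})))))
     else 0)"

end

theory Submission
  imports Defs
begin

text \<open>Let \<open>i\<^sub>x \<eta> = \<eta>(x, \<dots>)\<close>. Sorting the terms of \<open>d\<^sup>s \<eta>\<close> by whether they involve the first argument
  gives a Cartan formula \<open>i\<^sub>x d\<^sup>s \<eta> = L\<^sub>x \<eta> - d\<^sup>s\<^sup>+\<^sup>1 i\<^sub>\<alpha>\<^sub>x \<eta>\<close>, and the twisted Lie derivative \<open>L\<^sub>x\<close> satisfies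
  a similar recursion. With \<open>m = k + s\<close> and \<open>P x = \<beta>\<^sup>m\<^sup>+\<^sup>1 \<rho>(x) \<beta>\<^sup>-\<^sup>m\<^sup>-\<^sup>2\<close>, the number \<open>m\<close>, and so \<open>P\<close>, does not
  change along the recursion, while raising \<open>m\<close> by one replaces \<open>P\<close> by \<open>P \<circ> \<alpha>\<close>. In these terms the
  representation property says that \<open>P [x, y]\<close> is the commutator of \<open>P (\<alpha> x)\<close> and \<open>P (\<alpha> y)\<close>. Hence \<open>L\<close>
  represents the bracket, up to twist, on cochains, \<open>L\<close> commutes with \<open>d\<close>, and finally
  \<open>i\<^sub>x d d \<eta> = L\<^sub>x d \<eta> - d L\<^sub>\<alpha>\<^sub>x \<eta> + d d i\<^sub>\<alpha>\<^sub>\<alpha>\<^sub>x \<eta>\<close> vanishes, each by induction on the number of arguments.\<close>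

section \<open>Multilinear and alternating maps on lists, and cochains\<close>

definition multilinear ::
  "('f::field \<Rightarrow> 'g::ab_group_add \<Rightarrow> 'g) \<Rightarrow> ('f \<Rightarrow> 'v::ab_group_add \<Rightarrow> 'v) \<Rightarrow> ('g list \<Rightarrow> 'v) \<Rightarrow> bool"
  where "multilinear scale scaleV \<eta> \<longleftrightarrow>
    (\<forall>us vs. Vector_Spaces.linear scale scaleV (\<lambda>x. \<eta> (us @ x # vs)))"

text \<open>Only neighbouring entries are compared, which suits induction along the list;
  \<open>alternating_eq_0\<close> recovers arbitrary positions.\<close>

definition alternating :: "('g list \<Rightarrow> 'v::zero) \<Rightarrow> bool"
  where "alternating \<eta> \<longleftrightarrow> (\<forall>us a vs. \<eta> (us @ a # a # vs) = 0)"

lemma multilinearD: "multilinear scale scaleV \<eta> \<Longrightarrow> Vector_Spaces.linear scale scaleV (\<lambda>x. \<eta> (us @ x # vs))"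
  by (simp add: multilinear_def)

lemma multilinear_Cons: "multilinear scale scaleV \<eta> \<Longrightarrow> multilinear scale scaleV (\<lambda>zs. \<eta> (x # zs))"
  using multilinearD[of scale scaleV \<eta> "x # us" for us] by (simp add: multilinear_def)

lemma alternatingD: "alternating \<eta> \<Longrightarrow> \<eta> (us @ a # a # vs) = 0"
  by (simp add: alternating_def)

lemma alternating_Cons: "alternating \<eta> \<Longrightarrow> alternating (\<lambda>zs. \<eta> (x # zs))"
  using alternatingD[of \<eta> "x # us" for us] by (simp add: alternating_def)

lemma multilinear_add:
  "multilinear scale scaleV \<eta> \<Longrightarrow> \<eta> (us @ (x + y) # vs) = \<eta> (us @ x # vs) + \<eta> (us @ y # vs)"
  using multilinearD[of scale scaleV \<eta> us vs] by (simp add: Vector_Spaces.linear_iff)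

lemma alternating_swap:
  assumes "multilinear scale scaleV \<eta>" "alternating \<eta>"
  shows "\<eta> (us @ a # b # vs) = - \<eta> (us @ b # a # vs)"
proof -
  \<comment> \<open>Polarization: put \<open>a + b\<close> in both neighbouring slots and
    expand.\<close>
  have "\<eta> (us @ (a + b) # (a + b) # vs)
      = \<eta> (us @ a # a # vs) + \<eta> (us @ a # b # vs) + (\<eta> (us @ b # a # vs) + \<eta> (us @ b # b # vs))"
    using multilinear_add[OF assms(1), of us a b "(a + b) # vs"]
      multilinear_add[OF assms(1), of "us @ [a]" a b vs]
      multilinear_add[OF assms(1), of "us @ [b]" a b vs] by simp
  then show ?thesis
    by (simp add: alternatingD[OF assms(2)] eq_neg_iff_add_eq_0)
qed

text \<open>Swaps of neighbours carry the first \<open>a\<close> through \<open>vs\<close> until it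
  meets the second.\<close>

lemma alternating_eq_0:
  assumes "multilinear scale scaleV \<eta>" "alternating \<eta>"
  shows "\<eta> (us @ a # vs @ a # ws) = 0"
proof (induction vs arbitrary: us)
  case Nil
  then show ?case by (simp add: alternatingD[OF assms(2)])
next
  case (Cons b vs)
  show ?case
    using alternating_swap[OF assms, of us a b "vs @ a # ws"] Cons[of "us @ [b]"] by simp
qed

lemma cochains_multilinear:
  assumes "vector_space scale" "vector_space scaleV" "\<eta> \<in> cochains scale scaleV k"
  shows "multilinear scale scaleV \<eta>"
  unfolding multilinear_def
proof (intro allI)
  interpret V: vector_space scaleV by fact
  fix us vs
  show "Vector_Spaces.linear scale scaleV (\<lambda>x. \<eta> (us @ x # vs))"
  proof (cases "length (us @ 0 # vs) = k")
    case True
    have "Vector_Spaces.linear scale scaleV (\<lambda>x. \<eta> (xs[i := x]))"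
      if "length xs = k" "i < k" for xs i
      using assms(3) that by (simp add: cochains_def)
    from this[of "us @ 0 # vs" "length us"] True show ?thesis by simp
  next
    case False
    then have "\<eta> (us @ x # vs) = 0" for x
      using assms(3) by (simp add: cochains_def)
    then show ?thesis
      using assms(1,2) by (simp add: Vector_Spaces.linear_iff)
  qed
qed

lemma cochains_alternating:
  assumes "\<eta> \<in> cochains scale scaleV k"
  shows "alternating \<eta>"
  unfolding alternating_def
proof (intro allI)
  fix us a vs
  show "\<eta> (us @ a # a # vs) = 0"
  proof (cases "length (us @ a # a # vs) = k")
    case True
    moreover have "(us @ a # a # vs) ! length us = (us @ a # a # vs) ! Suc (length us)"
      by (simp add: nth_append)
    moreover have "length us < Suc (length us)" "Suc (length us) < k"
      using True by auto
    ultimately show ?thesis using assms unfolding cochains_def by blast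
  next
    case False
    then show ?thesis using assms unfolding cochains_def by auto
  qed
qed

lemma cochainsI:
  assumes "\<And>xs. length xs \<noteq> k \<Longrightarrow> \<eta> xs = 0"
    and "multilinear scale scaleV \<eta>" and "alternating \<eta>"
  shows "\<eta> \<in> cochains scale scaleV k"
proof -
  have "Vector_Spaces.linear scale scaleV (\<lambda>x. \<eta> (xs[i := x]))" if "i < length xs" for xs i
    using multilinearD[OF assms(2), of "take i xs" "drop (Suc i) xs"] that
    by (simp add: upd_conv_take_nth_drop)
  moreover have "\<eta> xs = 0" if "i < j" "j < length xs" "xs ! i = xs ! j" for xs i j
  proof -
    \<comment> \<open>From here \<open>k\<close> is the position of entry \<open>j\<close> in the
      tail behind entry \<open>i\<close>, not the degree.\<close>
    define k where "k = j - Suc i"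
    have "xs = take i xs @ xs ! i # drop (Suc i) xs"
      using that by (intro id_take_nth_drop) simp
    moreover have "drop (Suc i) xs = take k (drop (Suc i) xs) @ drop (Suc i) xs ! k # drop (Suc k) (drop (Suc i) xs)"
      using that by (intro id_take_nth_drop) (simp add: k_def)
    moreover have "drop (Suc i) xs ! k = xs ! i"
      using that by (simp add: k_def)
    ultimately show ?thesis
      using alternating_eq_0[OF assms(2,3)] by metis
  qed
  ultimately show ?thesis
    using assms(1) unfolding cochains_def by auto
qed

section \<open>Recursive Lie derivative and differential\<close>

context hom_lie_algebra
begin

text \<open>\<open>P\<close> acts only once the list is exhausted, so it stays fixed while the
  recursion lowers the degree of the cochain.\<close>

primrec lie_der :: "('g \<Rightarrow> 'v \<Rightarrow> 'v::ab_group_add) \<Rightarrow> 'g \<Rightarrow> ('g list \<Rightarrow> 'v) \<Rightarrow> 'g list \<Rightarrow> 'v"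
  where
    "lie_der P x \<eta> [] = P x (\<eta> [])"
  | "lie_der P x \<eta> (y # ys) =
      lie_der P x (\<lambda>zs. \<eta> (\<alpha> y # zs)) ys - \<eta> (bracket x y # map \<alpha> ys)"

text \<open>The Cartan formula serves as the definition. The value at \<open>[]\<close> is 0 because
  a differential has degree at least 1.\<close>

primrec ext_der :: "('g \<Rightarrow> 'v \<Rightarrow> 'v::ab_group_add) \<Rightarrow> ('g list \<Rightarrow> 'v) \<Rightarrow> 'g list \<Rightarrow> 'v"
  where
    "ext_der P \<eta> [] = 0"
  | "ext_der P \<eta> (x # xs) = lie_der P x \<eta> xs - ext_der P (\<lambda>zs. \<eta> (\<alpha> x # zs)) xs"

text \<open>Since \<alpha> preserves brackets, pullback along \<alpha> turns \<open>P\<close> into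
  \<open>P \<circ> \<alpha>\<close>. This handles the \<open>map \<alpha>\<close> that bracket terms
  carry.\<close>

lemma lie_der_map:
  "lie_der (\<lambda>x. P (\<alpha> x)) x (\<lambda>zs. \<eta> (map \<alpha> zs)) ys = lie_der P (\<alpha> x) \<eta> (map \<alpha> ys)"
  by (induction ys arbitrary: \<eta>) (simp_all add: alpha_bracket)

lemma ext_der_map:
  "ext_der (\<lambda>x. P (\<alpha> x)) (\<lambda>zs. \<eta> (map \<alpha> zs)) ys = ext_der P \<eta> (map \<alpha> ys)"
  by (induction ys arbitrary: \<eta>) (simp_all add: lie_der_map)

lemma bracket_swap: "bracket x y = - bracket y x"
proof -
  have "bracket (x + y) (x + y) = bracket x x + bracket x y + (bracket y x + bracket y y)"
    using bracket_linear_left bracket_linear_right by (simp add: Vector_Spaces.linear_iff)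
  then show ?thesis by (simp add: bracket_self eq_neg_iff_add_eq_0)
qed

text \<open>The Leibniz form of the Hom-Jacobi identity, as needed when two Lie derivatives are
  commuted.\<close>

lemma hom_jacobi':
  "bracket (\<alpha> x) (bracket y z) = bracket (bracket x y) (\<alpha> z) + bracket (\<alpha> y) (bracket x z)"
proof -
  have neg: "bracket u (- v) = - bracket u v" for u v
    using Vector_Spaces.linear.axioms(3)[OF bracket_linear_right] module_hom.neg by blast
  show ?thesis
    using hom_jacobi[of x y z] bracket_swap[of "bracket x y" "\<alpha> z"] bracket_swap[of z x]
    by (simp add: neg algebra_simps)
qed

end

section \<open>Cartan calculus for a twisted action\<close>

locale twisted_action = hom_lie_algebra scale bracket \<alpha> + V: vector_space scaleV
  for scale :: "'f::field \<Rightarrow> 'g::ab_group_add \<Rightarrow> 'g"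
    and bracket :: "'g \<Rightarrow> 'g \<Rightarrow> 'g"
    and \<alpha> :: "'g \<Rightarrow> 'g"
    and scaleV :: "'f \<Rightarrow> 'v::ab_group_add \<Rightarrow> 'v" +
  fixes P :: "'g \<Rightarrow> 'v \<Rightarrow> 'v"
  assumes endo: "Vector_Spaces.linear scaleV scaleV (P x)"
    and linear_arg: "Vector_Spaces.linear scale scaleV (\<lambda>x. P x v)"
    and commutator: "P (bracket x y) v = P (\<alpha> x) (P (\<alpha> y) v) - P (\<alpha> y) (P (\<alpha> x) v)"
begin

sublocale GV: vector_space_pair scale scaleV ..

text \<open>The outer operator of a composition acts one degree higher, with
  \<open>P \<circ> \<alpha>\<close>; this makes all lemmas of the locale available for it.\<close>

lemma twisted: "twisted_action scale bracket \<alpha> scaleV (\<lambda>x. P (\<alpha> x))"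
proof (intro twisted_action.intro twisted_action_axioms.intro hom_lie_algebra_axioms V.vector_space_axioms)
  show "Vector_Spaces.linear scaleV scaleV (P (\<alpha> x))" for x
    by (rule endo)
  show "Vector_Spaces.linear scale scaleV (\<lambda>x. P (\<alpha> x) v)" for v
    using Vector_Spaces.linear_compose[OF alpha_linear linear_arg] by (simp add: comp_def)
  show "P (\<alpha> (bracket x y)) v = P (\<alpha> (\<alpha> x)) (P (\<alpha> (\<alpha> y)) v) - P (\<alpha> (\<alpha> y)) (P (\<alpha> (\<alpha> x)) v)" for x y v
    by (simp add: alpha_bracket commutator)
qed

lemma action_0: "P x 0 = 0"
  using Vector_Spaces.linear.axioms(3)[OF endo] module_hom.zero by blast

lemma action_diff: "P x (u - v) = P x u - P x v"
  using Vector_Spaces.linear.axioms(3)[OF endo] module_hom.diff by blast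

lemma lie_der_0: "(\<And>zs. length zs = length ys \<Longrightarrow> \<eta> zs = 0) \<Longrightarrow> lie_der P x \<eta> ys = 0"
  by (induction ys arbitrary: \<eta>) (simp_all add: action_0)

lemma ext_der_0: "(\<And>zs. Suc (length zs) = length xs \<Longrightarrow> \<eta> zs = 0) \<Longrightarrow> ext_der P \<eta> xs = 0"
  by (induction xs arbitrary: \<eta>) (simp_all add: lie_der_0)

lemma lie_der_diff:
  "lie_der P x (\<lambda>zs. \<eta> zs - \<theta> zs) ys = lie_der P x \<eta> ys - lie_der P x \<theta> ys"
  by (induction ys arbitrary: \<eta> \<theta>) (simp_all add: action_diff)

lemma ext_der_diff:
  "ext_der P (\<lambda>zs. \<eta> zs - \<theta> zs) xs = ext_der P \<eta> xs - ext_der P \<theta> xs"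
  by (induction xs arbitrary: \<eta> \<theta>) (simp_all add: lie_der_diff)

text \<open>At \<open>[]\<close> this is \<open>commutator\<close>. In the step the terms with a
  single bracket are, by \<open>lie_der_map\<close>, symmetric in \<open>x\<close> and
  \<open>y\<close> and cancel, while the nested brackets combine by
  \<open>hom_jacobi'\<close>.\<close>

lemma lie_der_bracket:
  assumes "multilinear scale scaleV \<eta>"
  shows "lie_der (\<lambda>x. P (\<alpha> x)) x (lie_der P (\<alpha> y) \<eta>) zs
       - lie_der (\<lambda>x. P (\<alpha> x)) y (lie_der P (\<alpha> x) \<eta>) zs
       = lie_der P (bracket x y) \<eta> (map \<alpha> zs)"
  using assms
proof (induction zs arbitrary: \<eta>)
  case Nil
  then show ?case by (simp add: commutator)
next
  case (Cons z zs)
  interpret Q: twisted_action scale bracket \<alpha> scaleV "\<lambda>x. P (\<alpha> x)" by (rule twisted)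
  have "\<eta> (bracket (\<alpha> x) (bracket y z) # map \<alpha> (map \<alpha> zs))
      = \<eta> (bracket (bracket x y) (\<alpha> z) # map \<alpha> (map \<alpha> zs))
      + \<eta> (bracket (\<alpha> y) (bracket x z) # map \<alpha> (map \<alpha> zs))"
    using multilinear_add[OF Cons.prems, of "[]"] by (simp add: hom_jacobi'[of x])
  then show ?case
    using Cons.IH[OF multilinear_Cons[OF Cons.prems], of "\<alpha> (\<alpha> z)"]
      lie_der_map[of P x "\<lambda>zs. \<eta> (bracket (\<alpha> y) (\<alpha> z) # zs)" zs]
      lie_der_map[of P y "\<lambda>zs. \<eta> (bracket (\<alpha> x) (\<alpha> z) # zs)" zs]
    by (simp add: Q.lie_der_diff alpha_bracket algebra_simps)
qed

text \<open>Splitting off \<open>y\<close> leaves Lie derivatives along \<open>x\<close> and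
  \<open>y\<close> in both orders; their difference is \<open>lie_der_bracket\<close>, and
  \<open>ext_der_map\<close> matches the differentials of the bracket terms.\<close>

lemma lie_der_ext_der:
  assumes "multilinear scale scaleV \<eta>"
  shows "lie_der (\<lambda>x. P (\<alpha> x)) x (ext_der P \<eta>) ys = ext_der (\<lambda>x. P (\<alpha> x)) (lie_der P (\<alpha> x) \<eta>) ys"
  using assms
proof (induction ys arbitrary: \<eta>)
  case Nil
  then show ?case by (simp add: action_0)
next
  case (Cons y ys)
  interpret Q: twisted_action scale bracket \<alpha> scaleV "\<lambda>x. P (\<alpha> x)" by (rule twisted)
  show ?case
    using Cons.IH[OF multilinear_Cons[OF Cons.prems], of "\<alpha> (\<alpha> y)"]
      lie_der_bracket[OF Cons.prems, of x y ys]
      ext_der_map[of P "\<lambda>zs. \<eta> (bracket (\<alpha> x) (\<alpha> y) # zs)" ys]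
    by (simp add: Q.lie_der_diff Q.ext_der_diff alpha_bracket algebra_simps)
qed

lemma ext_der_ext_der:
  assumes "multilinear scale scaleV \<eta>"
  shows "ext_der (\<lambda>x. P (\<alpha> x)) (ext_der P \<eta>) xs = 0"
  using assms
proof (induction xs arbitrary: \<eta>)
  case (Cons x xs)
  interpret Q: twisted_action scale bracket \<alpha> scaleV "\<lambda>x. P (\<alpha> x)" by (rule twisted)
  show ?case
    using Cons.IH[OF multilinear_Cons[OF Cons.prems], of "\<alpha> (\<alpha> x)"]
    by (simp add: Q.ext_der_diff lie_der_ext_der[OF Cons.prems])
qed simp

text \<open>The variable sits in the cochain itself, which is where the recursion puts an entry once
  it is consumed.\<close>

lemma linear_lie_der_family:
  "(\<And>zs. Vector_Spaces.linear scale scaleV (\<lambda>y. \<eta> y zs))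
    \<Longrightarrow> Vector_Spaces.linear scale scaleV (\<lambda>y. lie_der P x (\<eta> y) ys)"
proof (induction ys arbitrary: \<eta>)
  case Nil
  then show ?case
    using Vector_Spaces.linear_compose[OF Nil[of "[]"] endo[of x]] by (simp add: comp_def)
qed (simp add: GV.linear_compose_sub)

lemma linear_ext_der_family:
  "(\<And>zs. Vector_Spaces.linear scale scaleV (\<lambda>y. \<eta> y zs))
    \<Longrightarrow> Vector_Spaces.linear scale scaleV (\<lambda>y. ext_der P (\<eta> y) xs)"
  by (induction xs arbitrary: \<eta>) (simp_all add: GV.linear_compose_sub GV.linear_zero linear_lie_der_family)

lemma linear_Cons_comp:
  assumes "multilinear scale scaleV \<eta>" "Vector_Spaces.linear scale scale f"
  shows "Vector_Spaces.linear scale scaleV (\<lambda>y. \<eta> (us @ f y # vs))"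
  using Vector_Spaces.linear_compose[OF assms(2) multilinearD[OF assms(1), of us vs]] by (simp add: comp_def)

lemma linear_lie_der:
  "multilinear scale scaleV \<eta> \<Longrightarrow> Vector_Spaces.linear scale scaleV (\<lambda>x. lie_der P x \<eta> ys)"
proof (induction ys arbitrary: \<eta>)
  case (Cons y ys)
  show ?case
    using Cons.IH[OF multilinear_Cons[OF Cons.prems]]
      linear_Cons_comp[OF Cons.prems bracket_linear_left, of "[]"]
    by (simp add: GV.linear_compose_sub)
qed (simp add: linear_arg)

lemma multilinear_lie_der:
  assumes "multilinear scale scaleV \<eta>"
  shows "multilinear scale scaleV (lie_der P x \<eta>)"
  unfolding multilinear_def
proof (intro allI)
  fix us vs
  show "Vector_Spaces.linear scale scaleV (\<lambda>y. lie_der P x \<eta> (us @ y # vs))"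
    using assms
  proof (induction us arbitrary: \<eta>)
    case Nil
    show ?case
      using linear_Cons_comp[OF Nil bracket_linear_right, of "[]"]
        linear_Cons_comp[OF Nil alpha_linear, of "[]"]
      by (simp add: GV.linear_compose_sub linear_lie_der_family)
  next
    case (Cons u us)
    show ?case
      using Cons.IH[OF multilinear_Cons[OF Cons.prems], of "\<alpha> u"]
        linear_Cons_comp[OF Cons.prems alpha_linear, of "bracket x u # map \<alpha> us" "map \<alpha> vs"]
      by (simp add: GV.linear_compose_sub)
  qed
qed

lemma multilinear_ext_der:
  assumes "multilinear scale scaleV \<eta>"
  shows "multilinear scale scaleV (ext_der P \<eta>)"
  unfolding multilinear_def
proof (intro allI)
  fix us vs
  show "Vector_Spaces.linear scale scaleV (\<lambda>y. ext_der P \<eta> (us @ y # vs))"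
    using assms
  proof (induction us arbitrary: \<eta>)
    case Nil
    show ?case
      using linear_Cons_comp[OF Nil alpha_linear, of "[]"]
      by (simp add: GV.linear_compose_sub linear_ext_der_family linear_lie_der[OF Nil])
  next
    case (Cons u us)
    show ?case
      using Cons.IH[OF multilinear_Cons[OF Cons.prems], of "\<alpha> u"]
        multilinearD[OF multilinear_lie_der[OF Cons.prems], of u us vs]
      by (simp add: GV.linear_compose_sub)
  qed
qed

lemma alternating_lie_der:
  assumes "multilinear scale scaleV \<eta>" "alternating \<eta>"
  shows "alternating (lie_der P x \<eta>)"
  unfolding alternating_def
proof (intro allI)
  fix us a vs
  show "lie_der P x \<eta> (us @ a # a # vs) = 0"
    using assms
  proof (induction us arbitrary: \<eta>)
    case Nil
    show ?case
      \<comment> \<open>The two bracket terms have \<open>bracket x a\<close> and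
        \<open>\<alpha> a\<close> in opposite orders, so they cancel.\<close>
      using alternating_swap[OF Nil, of "[]" "bracket x a" "\<alpha> a" "map \<alpha> vs"]
        alternatingD[OF Nil(2), of "[]"]
      by (simp add: lie_der_0)
  next
    case (Cons u us)
    show ?case
      using Cons.IH[OF multilinear_Cons[OF Cons.prems(1)] alternating_Cons[OF Cons.prems(2)]]
        alternatingD[OF Cons.prems(2), of "bracket x u # map \<alpha> us"]
      by simp
  qed
qed

lemma alternating_ext_der:
  assumes "multilinear scale scaleV \<eta>" "alternating \<eta>"
  shows "alternating (ext_der P \<eta>)"
  unfolding alternating_def
proof (intro allI)
  fix us a vs
  show "ext_der P \<eta> (us @ a # a # vs) = 0"
    using assms
  proof (induction us arbitrary: \<eta>)
    case Nil
    \<comment> \<open>The Lie derivatives along the two copies of \<open>a\<close> cancel, leaving a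
      term headed by \<open>bracket a a\<close>, which is 0.\<close>
    have "\<eta> (0 # zs) = 0" for zs
      using multilinearD[OF Nil(1), of "[]" zs] GV.linear_0 by force
    then show ?case
      using alternatingD[OF Nil(2), of "[]"]
      by (simp add: ext_der_0 bracket_self)
  next
    case (Cons u us)
    show ?case
      using Cons.IH[OF multilinear_Cons[OF Cons.prems(1)] alternating_Cons[OF Cons.prems(2)]]
        alternatingD[OF alternating_lie_der[OF Cons.prems]]
      by simp
  qed
qed

section \<open>From the recursions to explicit alternating sums\<close>

lemma lie_der_eq_sum:
  assumes "multilinear scale scaleV \<eta>" "alternating \<eta>"
  shows "lie_der P x \<eta> ys = P x (\<eta> (map \<alpha> ys))
    - (\<Sum>j<length ys. scaleV ((- 1) ^ j) (\<eta> (bracket x (ys ! j) # map \<alpha> (nths ys (- {j})))))"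
  using assms
proof (induction ys arbitrary: \<eta>)
  case (Cons y ys)
  have "{j. Suc j \<in> - {Suc i}} = - {i}" for i
    by auto
  then have nths: "nths (y # ys) (- {0}) = ys" "nths (y # ys) (- {Suc i}) = y # nths ys (- {i})" for i
    by (simp_all add: nths_Cons nths_all)
  \<comment> \<open>Shifting the index by one flips the sign of a summand; this swap
    compensates.\<close>
  have swap: "\<eta> (bracket v w # \<alpha> y # zs) = - \<eta> (\<alpha> y # bracket v w # zs)" for v w zs
    using alternating_swap[OF Cons.prems, of "[]" "bracket v w" "\<alpha> y" zs] by simp
  show ?case
    using Cons.IH[OF multilinear_Cons[OF Cons.prems(1)] alternating_Cons[OF Cons.prems(2)], of "\<alpha> y"]
    by (simp add: swap sum.lessThan_Suc_shift nths sum_negf del: sum.lessThan_Suc)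
qed simp

lemma ext_der_eq_sum:
  assumes "multilinear scale scaleV \<eta>" "alternating \<eta>"
  shows "ext_der P \<eta> xs =
      (\<Sum>i<length xs. scaleV ((- 1) ^ i) (P (xs ! i) (\<eta> (map \<alpha> (nths xs (- {i}))))))
    + (\<Sum>j<length xs. \<Sum>i<j. scaleV ((- 1) ^ (i + j))
        (\<eta> (bracket (xs ! i) (xs ! j) # map \<alpha> (nths xs (- {i, j})))))"
  using assms
proof (induction xs arbitrary: \<eta>)
  case (Cons x xs)
  have "{j. Suc j \<in> - {Suc i}} = - {i}" "{j. Suc j \<in> - {0, Suc i}} = - {i}"
    "{l. Suc l \<in> - {Suc i, Suc j}} = - {i, j}" for i j
    by auto
  then have nths: "nths (x # xs) (- {0}) = xs" "nths (x # xs) (- {Suc i}) = x # nths xs (- {i})"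
    "nths (x # xs) (- {0, Suc i}) = nths xs (- {i})"
    "nths (x # xs) (- {Suc i, Suc j}) = x # nths xs (- {i, j})" for i j
    by (simp_all add: nths_Cons nths_all)
  \<comment> \<open>Shifting both indices of a pair keeps its sign, so the minus in the recursion of
    \<open>ext_der\<close> has to come from this swap.\<close>
  have swap: "\<eta> (bracket v w # \<alpha> x # zs) = - \<eta> (\<alpha> x # bracket v w # zs)" for v w zs
    using alternating_swap[OF Cons.prems, of "[]" "bracket v w" "\<alpha> x" zs] by simp
  show ?case
    using Cons.IH[OF multilinear_Cons[OF Cons.prems(1)] alternating_Cons[OF Cons.prems(2)], of "\<alpha> x"]
    by (simp add: swap lie_der_eq_sum[OF Cons.prems] sum.lessThan_Suc_shift nths sum_negf sum_subtractf sum.distrib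
        algebra_simps del: sum.lessThan_Suc)
qed simp

end

section \<open>The twisted action given by a representation\<close>

definition conj_action :: "('v \<Rightarrow> 'v) \<Rightarrow> ('g \<Rightarrow> 'v \<Rightarrow> 'v) \<Rightarrow> nat \<Rightarrow> 'g \<Rightarrow> 'v \<Rightarrow> 'v"
  where "conj_action \<beta> \<rho> m x v = (\<beta> ^^ (m + 1)) (\<rho> x ((inv \<beta> ^^ (m + 2)) v))"

context hom_lie_representation
begin

sublocale VV: vector_space_pair scaleV scaleV ..

lemma linear_funpow:
  "Vector_Spaces.linear scaleV scaleV f \<Longrightarrow> Vector_Spaces.linear scaleV scaleV (f ^^ n)"
  by (induction n) (simp_all add: V.linear_id Vector_Spaces.linear_compose)

lemma linear_inv_beta: "bij \<beta> \<Longrightarrow> Vector_Spaces.linear scaleV scaleV (inv \<beta>)"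
proof -
  assume "bij \<beta>"
  then have inv: "inv \<beta> (\<beta> v) = v" "\<beta> (inv \<beta> v) = v" for v
    by (simp_all add: bij_is_inj bij_is_surj surj_f_inv_f)
  have beta: "\<beta> (u + v) = \<beta> u + \<beta> v" "\<beta> (scaleV c v) = scaleV c (\<beta> v)" for u v c
    using beta_linear by (simp_all add: Vector_Spaces.linear_iff)
  have "inv \<beta> (u + v) = inv \<beta> u + inv \<beta> v" "inv \<beta> (scaleV c v) = scaleV c (inv \<beta> v)" for u v c
    using inv(1)[of "inv \<beta> u + inv \<beta> v"] inv(1)[of "scaleV c (inv \<beta> v)"] by (simp_all add: beta inv)
  then show ?thesis
    using beta_linear by (simp add: Vector_Spaces.linear_iff)
qed

text \<open>For invertible \<beta>, \<open>rho_alpha\<close> says that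
  \<open>\<rho> (\<alpha> x)\<close> is the conjugate of \<open>\<rho> x\<close> by \<beta>, and one
  more conjugation raises \<open>m\<close> by one.\<close>

lemma conj_action_alpha:
  assumes "bij \<beta>"
  shows "conj_action \<beta> \<rho> m (\<alpha> x) = conj_action \<beta> \<rho> (Suc m) x"
proof
  fix v
  have "\<rho> (\<alpha> x) w = \<beta> (\<rho> x (inv \<beta> w))" for w
    using fun_cong[OF rho_alpha, of x "inv \<beta> w"] assms by (simp add: bij_is_surj surj_f_inv_f)
  then show "conj_action \<beta> \<rho> m (\<alpha> x) v = conj_action \<beta> \<rho> (Suc m) x v"
    by (simp add: conj_action_def funpow_swap1)
qed

lemma twisted_action_conj_action:
  assumes "bij \<beta>"
  shows "twisted_action scale bracket \<alpha> scaleV (conj_action \<beta> \<rho> m)"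
proof (intro twisted_action.intro twisted_action_axioms.intro hom_lie_algebra_axioms V.vector_space_axioms)
  have pow: "Vector_Spaces.linear scaleV scaleV (\<beta> ^^ n)" for n
    by (rule linear_funpow[OF beta_linear])
  show "Vector_Spaces.linear scaleV scaleV (conj_action \<beta> \<rho> m x)" for x
    using Vector_Spaces.linear_compose[OF Vector_Spaces.linear_compose[OF linear_funpow[OF linear_inv_beta[OF assms]] rho_endo] pow]
    unfolding conj_action_def[abs_def] comp_def .
  show "Vector_Spaces.linear scale scaleV (\<lambda>x. conj_action \<beta> \<rho> m x v)" for v
    using Vector_Spaces.linear_compose[OF rho_linear pow] unfolding conj_action_def comp_def .
  have inv: "inv \<beta> (\<beta> v) = v" "\<beta> (inv \<beta> v) = v" for v
    using assms by (simp_all add: bij_is_inj bij_is_surj surj_f_inv_f)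
  have inv_pow: "(inv \<beta> ^^ n) ((\<beta> ^^ n) v) = v" for n v
    by (induction n arbitrary: v) (simp_all add: funpow_swap1 inv)
  \<comment> \<open>At level \<open>Suc m\<close> the powers between the two factors collapse to a
    single \<open>inv \<beta>\<close>, which goes into turning \<open>\<rho> x\<close> back into
    \<open>\<rho> (\<alpha> x)\<close>.\<close>
  have comp: "conj_action \<beta> \<rho> m (\<alpha> x) (conj_action \<beta> \<rho> m (\<alpha> y) v)
      = (\<beta> ^^ (m + 1)) (\<rho> (\<alpha> x) (\<rho> y ((inv \<beta> ^^ (m + 3)) v)))" for x y v
  proof -
    have "\<rho> (\<alpha> x) w = \<beta> (\<rho> x (inv \<beta> w))" for w
      using fun_cong[OF rho_alpha, of x "inv \<beta> w"] by (simp add: inv)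
    moreover have "(inv \<beta> ^^ (m + 3)) ((\<beta> ^^ (m + 2)) u) = inv \<beta> u" for u
      using inv_pow[of "m + 2" u] by (simp add: numeral_3_eq_3)
    ultimately show ?thesis
      unfolding conj_action_alpha[OF assms] conj_action_def
      by (simp add: numeral_3_eq_3 funpow_swap1)
  qed
  show "conj_action \<beta> \<rho> m (bracket x y) v
      = conj_action \<beta> \<rho> m (\<alpha> x) (conj_action \<beta> \<rho> m (\<alpha> y) v)
      - conj_action \<beta> \<rho> m (\<alpha> y) (conj_action \<beta> \<rho> m (\<alpha> x) v)" for x y v
  proof -
    \<comment> \<open>Inserting \<open>\<beta>\<close> and \<open>inv \<beta>\<close> creates the
      argument of the form \<open>\<beta> v\<close> that \<open>rho_bracket\<close>
      requires.\<close>
    have "conj_action \<beta> \<rho> m (bracket x y) v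
        = (\<beta> ^^ (m + 1)) (\<rho> (bracket x y) (\<beta> ((inv \<beta> ^^ (m + 3)) v)))"
      by (simp add: conj_action_def numeral_3_eq_3 inv)
    then show ?thesis
      unfolding rho_bracket comp VV.linear_diff[OF pow] .
  qed
qed

lemma hom_lie_coboundary_eq_ext_der:
  assumes "bij \<beta>" "\<eta> \<in> cochains scale scaleV k"
  shows "hom_lie_coboundary bracket \<alpha> scaleV \<beta> \<rho> s k \<eta> = ext_der (conj_action \<beta> \<rho> (k + s)) \<eta>"
proof
  fix xs
  interpret twisted_action scale bracket \<alpha> scaleV "conj_action \<beta> \<rho> (k + s)"
    by (rule twisted_action_conj_action[OF assms(1)])
  show "hom_lie_coboundary bracket \<alpha> scaleV \<beta> \<rho> s k \<eta> xs = ext_der (conj_action \<beta> \<rho> (k + s)) \<eta> xs"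
  proof (cases "length xs = k + 1")
    case True
    have "multilinear scale scaleV \<eta>" "alternating \<eta>"
      using cochains_multilinear[OF vector_space_axioms V.vector_space_axioms assms(2)]
        cochains_alternating[OF assms(2)] .
    with True show ?thesis
      by (simp add: ext_der_eq_sum hom_lie_coboundary_def conj_action_def ac_simps)
  next
    case False
    then show ?thesis
      using assms(2) by (simp add: hom_lie_coboundary_def ext_der_0 cochains_def)
  qed
qed

end

theorem proposition2p3:
  fixes scale :: "'f::field \<Rightarrow> 'g::ab_group_add \<Rightarrow> 'g"
    and scaleV :: "'f \<Rightarrow> 'v::ab_group_add \<Rightarrow> 'v"
    and bracket :: "'g \<Rightarrow> 'g \<Rightarrow> 'g"
    and \<alpha> :: "'g \<Rightarrow> 'g"
    and \<beta> :: "'v \<Rightarrow> 'v"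
    and \<rho> :: "'g \<Rightarrow> 'v \<Rightarrow> 'v"
    and s k :: nat
  assumes "hom_lie_algebra scale bracket \<alpha>"
    and "vector_space scaleV"
    and "Vector_Spaces.linear scaleV scaleV \<beta>" and "bij \<beta>"
    and "hom_lie_representation scale bracket \<alpha> scaleV \<beta> \<rho>"
  shows "hom_lie_coboundary bracket \<alpha> scaleV \<beta> \<rho> s k
           \<in> cochains scale scaleV k \<rightarrow> cochains scale scaleV (k + 1) \<and>
         (\<forall>\<eta> \<in> cochains scale scaleV k.
            hom_lie_coboundary bracket \<alpha> scaleV \<beta> \<rho> s (k + 1)
              (hom_lie_coboundary bracket \<alpha> scaleV \<beta> \<rho> s k \<eta>) = (\<lambda>_. 0))"
proof -
  interpret hom_lie_representation scale bracket \<alpha> scaleV \<beta> \<rho> by fact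
  interpret twisted_action scale bracket \<alpha> scaleV "conj_action \<beta> \<rho> (k + s)"
    by (rule twisted_action_conj_action) fact
  note eq = hom_lie_coboundary_eq_ext_der[OF \<open>bij \<beta>\<close>]
  have ml: "multilinear scale scaleV \<eta>" if "\<eta> \<in> cochains scale scaleV k" for \<eta>
    using cochains_multilinear[OF vector_space_axioms V.vector_space_axioms that] .
  have closed: "ext_der (conj_action \<beta> \<rho> (k + s)) \<eta> \<in> cochains scale scaleV (k + 1)"
    if \<eta>: "\<eta> \<in> cochains scale scaleV k" for \<eta>
  proof (rule cochainsI)
    show "ext_der (conj_action \<beta> \<rho> (k + s)) \<eta> xs = 0" if "length xs \<noteq> k + 1" for xs
      using \<eta> that by (intro ext_der_0) (auto simp: cochains_def)
  qed (simp_all add: ml \<eta> cochains_alternating[OF \<eta>] multilinear_ext_der alternating_ext_der)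
  \<comment> \<open>The second differential acts in degree \<open>k + 1\<close>, so its action is
    the first one composed with \<alpha>, as in \<open>ext_der_ext_der\<close>.\<close>
  have Suc: "conj_action \<beta> \<rho> (k + 1 + s) = (\<lambda>x. conj_action \<beta> \<rho> (k + s) (\<alpha> x))"
    by (simp add: conj_action_alpha[OF \<open>bij \<beta>\<close>] fun_eq_iff)
  show ?thesis
  proof (intro conjI funcsetI ballI)
    fix \<eta> assume \<eta>: "\<eta> \<in> cochains scale scaleV k"
    show "hom_lie_coboundary bracket \<alpha> scaleV \<beta> \<rho> s k \<eta> \<in> cochains scale scaleV (k + 1)"
      unfolding eq[OF \<eta>] by (rule closed[OF \<eta>])
    show "hom_lie_coboundary bracket \<alpha> scaleV \<beta> \<rho> s (k + 1)
        (hom_lie_coboundary bracket \<alpha> scaleV \<beta> \<rho> s k \<eta>) = (\<lambda>_. 0)"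
      unfolding eq[OF \<eta>] eq[OF closed[OF \<eta>]] Suc by (rule ext) (rule ext_der_ext_der[OF ml[OF \<eta>]])
  qed
qed

end
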